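(* Let $A\in\mathbb{R}^{m\times n}$, $D\in\mathbb{R}^{p\times n}$, and let $l_i\in\mathbb{R}\cup\{-\infty\}$, $u_i\in\mathbb{R}\cup\{+\infty\}$ with $l_i<u_i$ for $i=1,\dots,n$. Let $\bar x\in\mathbb{R}^n$, put $b:=A\bar x$ and $\mathcal{X}:=\{x\in\mathbb{R}^n: Ax=b\}$, and suppose that $\bar x$ is a solution (minimizer) of $$\min_{x\in\mathbb{R}^n}\ \|Dx\|_1+\delta_{\mathcal{X}}(x)+\delta_{[l,u]}(x). \qquad (\ast)$$ Let $\Lambda:=\{i\in\{1,\dots,p\}:(D\bar x)_i=0\}$, let $\Lambda^c:=\{1,\dots,p\}\setminus\Lambda$, and let $\Psi\in\mathbb{R}^{n\times n}$ be the diagonal matrix with entries $$\Psi_{ii}=\begin{cases}-1,&\bar x_i=l_i,\\ 1,&\bar x_i=u_i,\\ 0,&\text{otherwise.}\end{cases}$$ Then $\bar x$ is the unique solution of $(\ast)$ if and only if both of the following conditions hold: (i) $\mathcal{N}(A)\cap\mathcal{N}(D_{\Lambda,\bullet})\cap\mathcal{N}(\Psi)=\{0\}$; (ii) there exist $\alpha\in\mathbb{R}^p$ and $\mu\in\mathbb{R}^n$ such that $D^\top\alpha+\Psi\mu\in\mathcal{R}(A^\top)$, $\alpha_{\Lambda^c}=\operatorname{sign}(D_{\Lambda^c,\bullet}\,\bar x)$, $\|\alpha_\Lambda\|_\infty<1$, and $\mu>0$.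
   Context: $\mathcal{N}(\cdot)$ and $\mathcal{R}(\cdot)$ denote nullspace and range of a matrix. $D_{\Lambda,\bullet}$ is the submatrix of $D$ formed by the rows indexed by $\Lambda$; $\alpha_\Lambda$ is the subvector of $\alpha$ indexed by $\Lambda$. $\operatorname{sign}$ is applied componentwise ($1$ for positive, $-1$ for negative entries). $\mu>0$ means every component is strictly positive. $\|\cdot\|_1$ is the $\ell_1$-norm, $\|\cdot\|_\infty$ the maximum norm (equal to $0$ for an empty vector). $\delta_C$ is the convex indicator function of a set $C$: $\delta_C(x)=0$ if $x\in C$ and $+\infty$ otherwise. $[l,u]:=\{x\in\mathbb{R}^n: l_i\le x_i\le u_i \text{ for all } i\}$. If $\Lambda$ is empty, $\mathcal{N}(D_{\Lambda,\bullet})=\mathbb{R}^n$. *)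

theory Defs
  imports "HOL-Analysis.Analysis"
begin

definition nullspace :: "real^'n^'m \<Rightarrow> (real^'n) set" where
  "nullspace M = {x. M *v x = 0}"

definition matrix_range :: "real^'n^'m \<Rightarrow> (real^'m) set" where
  "matrix_range M = range (\<lambda>x. M *v x)"

text \<open>The submatrix of \<open>D\<close> formed by the rows in \<open>\<Lambda>\<close> has no type of its own, since its number of
  rows is the cardinality of the set \<open>\<Lambda>\<close>. Its nullspace is therefore written row by row:
  the \<open>i\<close>-th entry of \<open>D *v x\<close> is the product of the \<open>i\<close>-th row of \<open>D\<close> with \<open>x\<close>.\<close>

definition nullspace_rows :: "real^'n^'p \<Rightarrow> 'p set \<Rightarrow> (real^'n) set" where
  "nullspace_rows D \<Lambda> = {x. \<forall>i\<in>\<Lambda>. (D *v x) $ i = 0}"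

lemma nullspace_rows_empty: "nullspace_rows D {} = UNIV"
  by (simp add: nullspace_rows_def)

lemma nullspace_rows_UNIV: "nullspace_rows D UNIV = nullspace D"
  by (simp add: nullspace_rows_def nullspace_def vec_eq_iff)

definition l1_norm :: "real^'n \<Rightarrow> real" where
  "l1_norm x = (\<Sum>i\<in>UNIV. \<bar>x $ i\<bar>)"

text \<open>The maximum norm of the subvector of \<open>x\<close> indexed by \<open>\<Lambda>\<close>.\<close>

definition max_norm_on :: "'n set \<Rightarrow> real^'n \<Rightarrow> real" where
  "max_norm_on \<Lambda> x = (if \<Lambda> = {} then 0 else Max ((\<lambda>i. \<bar>x $ i\<bar>) ` \<Lambda>))"

definition convex_indicator :: "'a set \<Rightarrow> 'a \<Rightarrow> ereal" where
  "convex_indicator C x = (if x \<in> C then 0 else \<infinity>)"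

definition ext_box :: "ereal^'n \<Rightarrow> ereal^'n \<Rightarrow> (real^'n) set" where
  "ext_box l u = {x. \<forall>i. l $ i \<le> ereal (x $ i) \<and> ereal (x $ i) \<le> u $ i}"

definition objective ::
  "real^'n^'m \<Rightarrow> real^'n^'p \<Rightarrow> real^'m \<Rightarrow> ereal^'n \<Rightarrow> ereal^'n \<Rightarrow> real^'n \<Rightarrow> ereal" where
  "objective A D b l u x =
     ereal (l1_norm (D *v x)) + convex_indicator {x. A *v x = b} x + convex_indicator (ext_box l u) x"

text \<open>Minimizers of an extended-real-valued function. A function that is identically \<open>\<infinity>\<close>
  (an infeasible problem) has no minimizers, as usual in convex analysis.\<close>

definition solutions :: "('a \<Rightarrow> ereal) \<Rightarrow> 'a set" where
  "solutions f = {x. f x \<noteq> \<infinity> \<and> is_arg_min f (\<lambda>_. True) x}"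

definition active_bounds_matrix :: "ereal^'n \<Rightarrow> ereal^'n \<Rightarrow> real^'n \<Rightarrow> real^'n^'n" where
  "active_bounds_matrix l u x =
     (\<chi> i j. if i = j
             then (if ereal (x $ i) = l $ i then - 1 else if ereal (x $ i) = u $ i then 1 else 0)
             else 0)"

end

theory Submission
  imports Defs
begin

text \<open>
  The proof passes from points to directions. Let \<open>K\<close> be the cone of feasible directions at
  \<open>xbar\<close>, that is, the \<open>h\<close> with \<open>A h = 0\<close> that do not point out of an active bound
  (\<open>\<Psi> h \<le> 0\<close>), and let \<open>g h\<close> be the directional derivative at \<open>xbar\<close> of \<open>x \<mapsto> \<parallel>D x\<parallel>\<^sub>1\<close>.

  The objective is polyhedral, so along each direction of \<open>K\<close> the problem is exactly linear for a
  short time; together with convexity this makes \<open>xbar\<close> the unique minimizer precisely when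
  \<open>g h > 0\<close> for every nonzero \<open>h \<in> K\<close> (\<open>unique_solution_iff\<close>).

  It remains to show that this strict positivity is equivalent to (i) and (ii). Given a certificate
  \<open>\<alpha>, \<mu>\<close>, pairing \<open>D\<^sup>T \<alpha> + \<Psi> \<mu> \<in> \<R>(A\<^sup>T)\<close> with \<open>h \<in> \<N>(A)\<close> gives zero, and comparing this
  with \<open>g h\<close> term by term leaves only nonnegative terms. They all vanish only if \<open>h\<close> lies
  in the intersection of null spaces of (i) (\<open>certificate_imp_pos\<close>). Conversely, (i) follows because
  that intersection is a subspace of \<open>K\<close> on which \<open>g\<close> is linear, hence changes sign.
  For (ii), if no certificate exists, then the convex set of all candidates
  \<open>D\<^sup>T \<alpha> + \<Psi> \<mu> + A\<^sup>T y\<close> misses the origin and is separated from it by a vector \<open>a \<noteq> 0\<close>; then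
  \<open>-a\<close> is a nonzero element of \<open>K\<close> with \<open>g (-a) \<le> 0\<close> (\<open>pos_imp_certificate\<close>). Mere weak separation
  suffices here, because positivity on \<open>K - {0}\<close> already excludes every nonzero \<open>a\<close>.
\<close>

section \<open>The directional derivative of the absolute value\<close>

definition abs_deriv :: "real \<Rightarrow> real \<Rightarrow> real" where
  "abs_deriv d e = (if d = 0 then \<bar>e\<bar> else sgn d * e)"

lemma abs_deriv_subgradient: "\<bar>d\<bar> + abs_deriv d e \<le> \<bar>d + e\<bar>"
  by (auto simp: abs_deriv_def sgn_if)

text \<open>For small steps the sign of \<open>d + t * e\<close> no longer changes, so the absolute value equals its
  first-order expansion.\<close>

lemma eventually_abs_eq_deriv:
  "\<forall>\<^sub>F t in at_right 0. \<bar>d + t * e\<bar> = \<bar>d\<bar> + t * abs_deriv d e"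
proof -
  have lim: "((\<lambda>t. d + t * e) \<longlongrightarrow> d + 0 * e) (at_right 0)"
    by (intro tendsto_intros)
  have pos: "\<forall>\<^sub>F t::real in at_right 0. 0 < t"
    by (simp add: eventually_at_right_less)
  consider "d = 0" | "d > 0" | "d < 0" by linarith
  then show ?thesis
  proof cases
    case 1
    show ?thesis
      using pos by eventually_elim (simp add: 1 abs_deriv_def abs_mult)
  next
    case 2
    have "\<forall>\<^sub>F t in at_right 0. 0 < d + t * e"
      using order_tendstoD(1)[OF lim, of 0] 2 by simp
    then show ?thesis
      by eventually_elim (use 2 in \<open>simp add: abs_deriv_def\<close>)
  next
    case 3
    have "\<forall>\<^sub>F t in at_right 0. d + t * e < 0"
      using order_tendstoD(2)[OF lim, of 0] 3 by simp
    then show ?thesis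
      by eventually_elim (use 3 in \<open>simp add: abs_deriv_def\<close>)
  qed
qed

section \<open>Uniqueness as positivity on feasible directions\<close>

lemma solutions_objective_iff:
  "x \<in> solutions (objective A D b l u) \<longleftrightarrow>
     A *v x = b \<and> x \<in> ext_box l u \<and>
     (\<forall>y. A *v y = b \<and> y \<in> ext_box l u \<longrightarrow> l1_norm (D *v x) \<le> l1_norm (D *v y))"
proof -
  have val: "objective A D b l u y =
      (if A *v y = b \<and> y \<in> ext_box l u then ereal (l1_norm (D *v y)) else \<infinity>)" for y
    by (auto simp: objective_def convex_indicator_def)
  show ?thesis
    unfolding solutions_def is_arg_min_def val
    by (auto simp: not_less split: if_splits)
qed

lemma active_bounds_matrix_mult:
  "(active_bounds_matrix l u x *v h) $ i =
     (if ereal (x $ i) = l $ i then - h $ i else if ereal (x $ i) = u $ i then h $ i else 0)"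
proof -
  have "(active_bounds_matrix l u x *v h) $ i =
      (\<Sum>j\<in>UNIV. if i = j then active_bounds_matrix l u x $ i $ i * h $ i else 0)"
    unfolding matrix_vector_mult_def vec_lambda_beta
    by (rule sum.cong) (simp_all add: active_bounds_matrix_def)
  then show ?thesis
    by (simp add: active_bounds_matrix_def)
qed

lemma transpose_active_bounds_matrix:
  "transpose (active_bounds_matrix l u x) = active_bounds_matrix l u x"
  by (auto simp: transpose_def active_bounds_matrix_def vec_eq_iff)

lemma ext_box_diff_feasible_direction:
  assumes "y \<in> ext_box l u"
  shows "(active_bounds_matrix l u x *v (y - x)) $ i \<le> 0"
proof -
  have "l $ i \<le> ereal (y $ i)" "ereal (y $ i) \<le> u $ i"
    using assms by (auto simp: ext_box_def)
  then show ?thesis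
    by (auto simp: active_bounds_matrix_mult dest: sym)
qed

lemma eventually_ereal_less_affine:
  fixes c d :: real
  assumes "a < ereal c"
  shows "\<forall>\<^sub>F t in at_right 0. a < ereal (c + t * d)"
proof -
  have "((\<lambda>t. ereal (c + t * d)) \<longlongrightarrow> ereal (c + 0 * d)) (at_right 0)"
    by (intro tendsto_intros)
  from order_tendstoD(1)[OF this, of a] assms show ?thesis by simp
qed

lemma eventually_affine_less_ereal:
  fixes c d :: real
  assumes "ereal c < a"
  shows "\<forall>\<^sub>F t in at_right 0. ereal (c + t * d) < a"
proof -
  have "((\<lambda>t. ereal (c + t * d)) \<longlongrightarrow> ereal (c + 0 * d)) (at_right 0)"
    by (intro tendsto_intros)
  from order_tendstoD(2)[OF this, of a] assms show ?thesis by simp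
qed

text \<open>An inactive bound has slack, which absorbs small steps; an active bound is respected
  because \<open>h\<close> does not point across it. The hypothesis \<open>l $ i < u $ i\<close> matters since
  \<^const>\<open>active_bounds_matrix\<close> records a single active bound per component.\<close>

lemma eventually_in_ext_box:
  assumes x: "x \<in> ext_box l u" and lu: "\<And>i. l $ i < u $ i"
    and h: "\<And>i. (active_bounds_matrix l u x *v h) $ i \<le> 0"
  shows "\<forall>\<^sub>F t in at_right 0. x + t *\<^sub>R h \<in> ext_box l u"
proof -
  have "\<forall>\<^sub>F t in at_right 0. l $ i \<le> ereal (x $ i + t * h $ i) \<and> ereal (x $ i + t * h $ i) \<le> u $ i"
    for i
  proof (rule eventually_conj)
    have pos: "\<forall>\<^sub>F t::real in at_right 0. 0 < t"
      by (simp add: eventually_at_right_less)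
    have bounds: "l $ i \<le> ereal (x $ i)" "ereal (x $ i) \<le> u $ i"
      using x by (auto simp: ext_box_def)
    show "\<forall>\<^sub>F t in at_right 0. l $ i \<le> ereal (x $ i + t * h $ i)"
    proof (cases "ereal (x $ i) = l $ i")
      case True
      then have "0 \<le> h $ i"
        using h[of i] by (simp add: active_bounds_matrix_mult)
      show ?thesis
        using pos by eventually_elim (use \<open>0 \<le> h $ i\<close> in \<open>simp flip: True\<close>)
    next
      case False
      with bounds have "l $ i < ereal (x $ i)" by simp
      from eventually_ereal_less_affine[OF this] show ?thesis
        by eventually_elim (rule less_imp_le)
    qed
    show "\<forall>\<^sub>F t in at_right 0. ereal (x $ i + t * h $ i) \<le> u $ i"
    proof (cases "ereal (x $ i) = u $ i")
      case True
      then have "h $ i \<le> 0"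
        using h[of i] lu[of i] by (auto simp: active_bounds_matrix_mult split: if_splits)
      show ?thesis
        using pos
        by eventually_elim (use \<open>h $ i \<le> 0\<close> in \<open>simp add: mult_nonneg_nonpos flip: True\<close>)
    next
      case False
      with bounds have "ereal (x $ i) < u $ i" by simp
      from eventually_affine_less_ereal[OF this] show ?thesis
        by eventually_elim (rule less_imp_le)
    qed
  qed
  then have "\<forall>\<^sub>F t in at_right 0. \<forall>i. l $ i \<le> ereal (x $ i + t * h $ i) \<and>
      ereal (x $ i + t * h $ i) \<le> u $ i"
    by (rule eventually_all_finite)
  then show ?thesis
    by eventually_elim (simp add: ext_box_def)
qed

lemma l1_norm_subgradient:
  "l1_norm d + (\<Sum>i\<in>UNIV. abs_deriv (d $ i) (e $ i)) \<le> l1_norm (d + e)"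
  unfolding l1_norm_def sum.distrib[symmetric]
  by (intro sum_mono) (simp add: abs_deriv_subgradient)

lemma eventually_l1_norm_eq_deriv:
  "\<forall>\<^sub>F t in at_right 0.
     l1_norm (d + t *\<^sub>R e) = l1_norm d + t * (\<Sum>i\<in>UNIV. abs_deriv (d $ i) (e $ i))"
proof -
  have "\<forall>\<^sub>F t in at_right 0. \<forall>i. \<bar>d $ i + t * e $ i\<bar> = \<bar>d $ i\<bar> + t * abs_deriv (d $ i) (e $ i)"
    by (intro eventually_all_finite eventually_abs_eq_deriv)
  then show ?thesis
    by eventually_elim (simp add: l1_norm_def sum.distrib sum_distrib_left)
qed

text \<open>If the derivative is nonpositive in a feasible direction, a short step along it yields a
  second minimizer; if it is positive in all of them, the subgradient inequality makes every
  other feasible point strictly worse.\<close>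

lemma unique_solution_iff:
  assumes lu: "\<And>i. l $ i < u $ i"
    and sol: "x \<in> solutions (objective A D b l u)"
  shows "solutions (objective A D b l u) = {x} \<longleftrightarrow>
    (\<forall>h. h \<noteq> 0 \<and> A *v h = 0 \<and> (\<forall>i. (active_bounds_matrix l u x *v h) $ i \<le> 0) \<longrightarrow>
       0 < (\<Sum>i\<in>UNIV. abs_deriv ((D *v x) $ i) ((D *v h) $ i)))"
    (is "?unique \<longleftrightarrow> ?pos")
proof
  assume unique: ?unique
  show ?pos
  proof (intro allI impI, elim conjE, rule ccontr)
    fix h
    assume "h \<noteq> 0" and Ah: "A *v h = 0"
      and h: "\<forall>i. (active_bounds_matrix l u x *v h) $ i \<le> 0"
      and "\<not> 0 < (\<Sum>i\<in>UNIV. abs_deriv ((D *v x) $ i) ((D *v h) $ i))"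
    then have deriv: "(\<Sum>i\<in>UNIV. abs_deriv ((D *v x) $ i) ((D *v h) $ i)) \<le> 0"
      by simp
    have x: "A *v x = b" "x \<in> ext_box l u"
      using sol by (simp_all add: solutions_objective_iff)
    have "\<forall>\<^sub>F t in at_right 0. 0 < t \<and> x + t *\<^sub>R h \<in> ext_box l u \<and>
        l1_norm (D *v x + t *\<^sub>R (D *v h)) =
        l1_norm (D *v x) + t * (\<Sum>i\<in>UNIV. abs_deriv ((D *v x) $ i) ((D *v h) $ i))"
      using x lu h
      by (intro eventually_conj eventually_in_ext_box eventually_l1_norm_eq_deriv)
        (auto simp: eventually_at_right_less)
    then obtain t where t: "0 < t" "x + t *\<^sub>R h \<in> ext_box l u"
      and eq: "l1_norm (D *v x + t *\<^sub>R (D *v h)) =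
        l1_norm (D *v x) + t * (\<Sum>i\<in>UNIV. abs_deriv ((D *v x) $ i) ((D *v h) $ i))"
      using eventually_happens[of _ "at_right (0::real)"] by force
    have "l1_norm (D *v (x + t *\<^sub>R h)) \<le> l1_norm (D *v x)"
      using t deriv eq
      by (simp add: matrix_vector_right_distrib matrix_vector_mult_scaleR mult_nonneg_nonpos)
    moreover have "A *v (x + t *\<^sub>R h) = b"
      using x Ah by (simp add: matrix_vector_right_distrib matrix_vector_mult_scaleR)
    ultimately have "x + t *\<^sub>R h \<in> solutions (objective A D b l u)"
      using sol t unfolding solutions_objective_iff by force
    with unique t \<open>h \<noteq> 0\<close> show False by simp
  qed
next
  assume pos: ?pos
  have "y = x" if y: "y \<in> solutions (objective A D b l u)" for y
  proof (rule ccontr)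
    assume "y \<noteq> x"
    moreover have "A *v (y - x) = 0"
      using sol y by (simp add: solutions_objective_iff matrix_vector_mult_diff_distrib)
    moreover have "\<forall>i. (active_bounds_matrix l u x *v (y - x)) $ i \<le> 0"
      using y by (auto simp: solutions_objective_iff intro: ext_box_diff_feasible_direction)
    ultimately have "0 < (\<Sum>i\<in>UNIV. abs_deriv ((D *v x) $ i) ((D *v (y - x)) $ i))"
      using pos by simp
    with l1_norm_subgradient[of "D *v x" "D *v (y - x)"]
    have "l1_norm (D *v x) < l1_norm (D *v y)"
      by (simp add: matrix_vector_mult_diff_distrib)
    with sol y show False
      by (force simp: solutions_objective_iff)
  qed
  with sol show ?unique by blast
qed

section \<open>Dual certificates\<close>

lemma inner_transpose_mult:
  fixes M :: "real^'n^'m"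
  shows "(transpose M *v y) \<bullet> h = y \<bullet> (M *v h)"
  by (simp add: dot_lmul_matrix)

lemma max_norm_on_less_one_iff: "max_norm_on \<Lambda> \<alpha> < 1 \<longleftrightarrow> (\<forall>i\<in>\<Lambda>. \<bar>\<alpha> $ i\<bar> < 1)"
  by (auto simp: max_norm_on_def)

text \<open>The easy half of the duality. The certificate is orthogonal to \<open>h\<close>, so the directional
  derivative equals the gap \<open>\<Sum>i. abs_deriv (d $ i) e\<^sub>i - \<alpha> $ i * e\<^sub>i\<close> (with \<open>e = D h\<close>)
  plus the slack \<open>- \<mu> \<bullet> \<Psi>\<^sup>T h\<close>. All terms are nonnegative, and the strict inequalities
  on \<open>\<alpha>\<close> and \<open>\<mu>\<close> turn vanishing of the sum into membership in the null spaces.\<close>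

lemma certificate_imp_pos:
  fixes A :: "real^'n^'m" and D :: "real^'n^'p" and \<Psi> :: "real^'q^'n"
  assumes cert: "transpose D *v \<alpha> + \<Psi> *v \<mu> \<in> matrix_range (transpose A)"
    and \<alpha>: "\<And>i. d $ i \<noteq> 0 \<Longrightarrow> \<alpha> $ i = sgn (d $ i)" "\<And>i. d $ i = 0 \<Longrightarrow> \<bar>\<alpha> $ i\<bar> < 1"
    and \<mu>: "\<And>i. \<mu> $ i > 0"
    and h: "A *v h = 0" "\<And>i. (transpose \<Psi> *v h) $ i \<le> 0"
    and outside: "h \<notin> nullspace_rows D {i. d $ i = 0} \<inter> nullspace (transpose \<Psi>)"
  shows "0 < (\<Sum>i\<in>UNIV. abs_deriv (d $ i) ((D *v h) $ i))"
proof -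
  define gap where "gap = (\<lambda>i. abs_deriv (d $ i) ((D *v h) $ i) - \<alpha> $ i * (D *v h) $ i)"
  define slack where "slack = (\<lambda>i. - (\<mu> $ i * (transpose \<Psi> *v h) $ i))"
  obtain y where y: "transpose D *v \<alpha> + \<Psi> *v \<mu> = transpose A *v y"
    using cert by (auto simp: matrix_range_def)
  have "(transpose D *v \<alpha> + \<Psi> *v \<mu>) \<bullet> h = 0"
    unfolding y inner_transpose_mult by (simp add: h)
  then have "\<alpha> \<bullet> (D *v h) + \<mu> \<bullet> (transpose \<Psi> *v h) = 0"
    using inner_transpose_mult[of "transpose \<Psi>" \<mu> h] by (simp add: inner_add_left dot_lmul_matrix)
  then have sum_eq: "(\<Sum>i\<in>UNIV. abs_deriv (d $ i) ((D *v h) $ i)) = sum gap UNIV + sum slack UNIV"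
    by (simp add: gap_def slack_def inner_vec_def sum_subtractf sum_negf)
  have gap_zero: "gap i = 0" if "d $ i \<noteq> 0" for i
    using that \<alpha>(1) by (simp add: gap_def abs_deriv_def)
  have gap_pos: "gap i > 0" if "d $ i = 0" "(D *v h) $ i \<noteq> 0" for i
  proof -
    have "\<alpha> $ i * (D *v h) $ i \<le> \<bar>\<alpha> $ i\<bar> * \<bar>(D *v h) $ i\<bar>"
      by (metis abs_ge_self abs_mult)
    also have "\<dots> < 1 * \<bar>(D *v h) $ i\<bar>"
      using that \<alpha>(2) by (intro mult_strict_right_mono) auto
    finally show ?thesis
      using that by (simp add: gap_def abs_deriv_def)
  qed
  have gap_nonneg: "gap i \<ge> 0" for i
  proof (cases "d $ i = 0 \<and> (D *v h) $ i \<noteq> 0")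
    case False
    then show ?thesis
      using gap_zero[of i] by (cases "d $ i = 0") (auto simp: gap_def abs_deriv_def)
  qed (use gap_pos[of i] in auto)
  have slack_nonneg: "slack i \<ge> 0" for i
    using \<mu>[of i] h(2)[of i] by (simp add: slack_def mult_nonneg_nonpos less_imp_le)
  consider i where "gap i > 0" | i where "slack i > 0"
  proof (cases "h \<in> nullspace_rows D {i. d $ i = 0}")
    case False
    then show ?thesis
      using gap_pos that(1) by (auto simp: nullspace_rows_def)
  next
    case True
    with outside obtain i where "(transpose \<Psi> *v h) $ i \<noteq> 0"
      by (auto simp: nullspace_def vec_eq_iff)
    with h(2)[of i] \<mu>[of i] have "slack i > 0"
      by (simp add: slack_def mult_pos_neg)
    then show ?thesis by (rule that(2))
  qed
  then show ?thesis
  proof cases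
    case 1
    then have "0 < sum gap UNIV"
      using gap_nonneg by (intro sum_pos2[of _ i]) auto
    moreover have "0 \<le> sum slack UNIV"
      using slack_nonneg by (intro sum_nonneg) auto
    ultimately show ?thesis by (simp add: sum_eq)
  next
    case 2
    then have "0 < sum slack UNIV"
      using slack_nonneg by (intro sum_pos2[of _ i]) auto
    moreover have "0 \<le> sum gap UNIV"
      using gap_nonneg by (intro sum_nonneg) auto
    ultimately show ?thesis by (simp add: sum_eq)
  qed
qed

lemma convex_component:
  fixes T :: "real set"
  assumes "convex T"
  shows "convex {x::real^'n. x $ i \<in> T}"
  using convex_linear_vimage[OF bounded_linear.linear[OF bounded_linear_vec_nth[of i]] assms]
  by (simp add: vimage_def)

text \<open>The hard half, by separation. If no certificate exists, some \<open>a \<noteq> 0\<close> has nonnegative inner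
  product with all vectors \<open>D\<^sup>T \<alpha> + \<Psi> \<mu> + A\<^sup>T y\<close> with admissible \<open>\<alpha>\<close> and \<open>\<mu>\<close>. With \<open>h = -a\<close>, varying \<open>y\<close> over a whole space forces \<open>A h = 0\<close>;
  letting one component of \<open>\<mu>\<close> grow forces \<open>\<Psi>\<^sup>T h \<le> 0\<close>; and letting \<open>\<mu>\<close> tend to zero while
  \<open>\<alpha>\<close> tends to the subgradient of the norm that attains the derivative in direction \<open>D h\<close> shows
  that this derivative is nonpositive.\<close>

lemma pos_imp_certificate:
  fixes A :: "real^'n^'m" and D :: "real^'n^'p" and \<Psi> :: "real^'q^'n"
  assumes pos: "\<And>h. h \<noteq> 0 \<Longrightarrow> A *v h = 0 \<Longrightarrow> (\<And>i. (transpose \<Psi> *v h) $ i \<le> 0) \<Longrightarrow>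
    0 < (\<Sum>i\<in>UNIV. abs_deriv (d $ i) ((D *v h) $ i))"
  obtains \<alpha> \<mu> where "transpose D *v \<alpha> + \<Psi> *v \<mu> \<in> matrix_range (transpose A)"
    and "\<And>i. d $ i \<noteq> 0 \<Longrightarrow> \<alpha> $ i = sgn (d $ i)" and "\<And>i. d $ i = 0 \<Longrightarrow> \<bar>\<alpha> $ i\<bar> < 1"
    and "\<And>i. \<mu> $ i > 0"
proof -
  define S :: "real^'p \<Rightarrow> bool" where
    "S = (\<lambda>\<alpha>. \<forall>i. if d $ i = 0 then \<bar>\<alpha> $ i\<bar> < 1 else \<alpha> $ i = sgn (d $ i))"
  define P :: "real^'q \<Rightarrow> bool" where "P = (\<lambda>\<mu>. \<forall>i. \<mu> $ i > 0)"
  define C where "C = {transpose D *v \<alpha> + \<Psi> *v \<mu> + transpose A *v y | \<alpha> \<mu> y. S \<alpha> \<and> P \<mu>}"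
  have convex_S: "convex (Collect S)"
  proof -
    have "Collect S = (\<Inter>i. {\<alpha>. \<alpha> $ i \<in> (if d $ i = 0 then {-1<..<1} else {sgn (d $ i)})})"
      by (auto simp: S_def abs_less_iff split: if_splits)
    then show ?thesis
      by (auto intro!: convex_INT convex_component simp del: greaterThanLessThan_iff)
  qed
  have convex_P: "convex (Collect P)"
  proof -
    have "Collect P = (\<Inter>i. {\<mu>. \<mu> $ i \<in> {0<..}})"
      by (auto simp: P_def)
    then show ?thesis
      by (auto intro!: convex_INT convex_component simp del: greaterThan_iff)
  qed
  have "\<exists>\<alpha> \<mu> y. S \<alpha> \<and> P \<mu> \<and> transpose D *v \<alpha> + \<Psi> *v \<mu> + transpose A *v y = 0"
  proof (rule ccontr)
    assume "\<not> ?thesis"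
    then have "0 \<notin> C" by (force simp: C_def)
    have "C = (\<Union>w \<in> (\<Union>v \<in> (*v) (transpose D) ` Collect S. \<Union>z \<in> (*v) \<Psi> ` Collect P. {v + z}).
        \<Union>z \<in> range ((*v) (transpose A)). {w + z})"
      unfolding C_def by auto
    moreover have "convex \<dots>"
      by (intro convex_sums convex_linear_image convex_S convex_P convex_UNIV
          matrix_vector_mul_linear)
    ultimately have "convex C" by simp
    from separating_hyperplane_set_0[OF this \<open>0 \<notin> C\<close>]
    obtain a where "a \<noteq> 0" and sep: "\<And>z. z \<in> C \<Longrightarrow> 0 \<le> a \<bullet> z"
      by auto
    define h where "h = - a"
    have le: "\<alpha> \<bullet> (D *v h) + \<mu> \<bullet> (transpose \<Psi> *v h) + y \<bullet> (A *v h) \<le> 0" if "S \<alpha>" "P \<mu>" for \<alpha> \<mu> y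
    proof -
      have "transpose D *v \<alpha> + \<Psi> *v \<mu> + transpose A *v y \<in> C"
        using that by (auto simp: C_def)
      then have "(transpose D *v \<alpha> + \<Psi> *v \<mu> + transpose A *v y) \<bullet> h \<le> 0"
        using sep by (simp add: h_def inner_commute[of _ a])
      then show ?thesis
        using inner_transpose_mult[of "transpose \<Psi>" \<mu> h]
        by (simp add: inner_add_left dot_lmul_matrix)
    qed
    define \<alpha>0 :: "real^'p" where "\<alpha>0 = (\<chi> i. sgn (d $ i))"
    define one :: "real^'q" where "one = (\<chi> i. 1)"
    have "S \<alpha>0" "P one" by (auto simp: S_def P_def \<alpha>0_def one_def)
    \<comment> \<open>A linear function bounded above on a ray has nonpositive slope; this is applied to the
      rays in \<open>y\<close> and in \<open>\<mu>\<close>.\<close>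
    have slope: "s \<le> 0" if bound: "\<And>t::real. t \<ge> 0 \<Longrightarrow> c + t * s \<le> 0" for c s
    proof (rule ccontr)
      assume "\<not> s \<le> 0"
      then have "0 < s" by simp
      have "c + (\<bar>c\<bar> + 1) / s * s \<le> 0"
        by (rule bound) (use \<open>0 < s\<close> in simp)
      with \<open>0 < s\<close> show False by simp
    qed
    have Ah: "A *v h = 0"
    proof -
      have "(A *v h) \<bullet> (A *v h) \<le> 0"
      proof (rule slope)
        fix t :: real
        show "(\<alpha>0 \<bullet> (D *v h) + one \<bullet> (transpose \<Psi> *v h)) + t * ((A *v h) \<bullet> (A *v h)) \<le> 0"
          using le[OF \<open>S \<alpha>0\<close> \<open>P one\<close>, of "t *\<^sub>R (A *v h)"] by simp
      qed
      then show ?thesis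
        by (metis inner_ge_zero inner_eq_zero_iff order_antisym)
    qed
    have \<Psi>h: "(transpose \<Psi> *v h) $ i \<le> 0" for i
    proof (rule slope)
      fix t :: real
      assume "t \<ge> 0"
      then have "P (one + t *\<^sub>R axis i 1)"
        by (auto simp: P_def one_def axis_def)
      from le[OF \<open>S \<alpha>0\<close> this, of 0]
      show "(\<alpha>0 \<bullet> (D *v h) + one \<bullet> (transpose \<Psi> *v h)) + t * (transpose \<Psi> *v h) $ i \<le> 0"
        by (simp add: inner_add_left inner_axis' algebra_simps)
    qed
    define g where "g = (\<Sum>i\<in>UNIV. abs_deriv (d $ i) ((D *v h) $ i))"
    define M where "M = (\<Sum>i\<in>UNIV. if d $ i = 0 then \<bar>(D *v h) $ i\<bar> else 0)
      - one \<bullet> (transpose \<Psi> *v h)"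
    \<comment> \<open>Shrinking the extremal subgradient by the factor \<open>1 - \<epsilon>\<close> on the zero set makes it
      admissible; \<open>M\<close> collects all terms of first order in \<open>\<epsilon>\<close>.\<close>
    have g_le: "g \<le> \<epsilon> * M" if "0 < \<epsilon>" "\<epsilon> < 1" for \<epsilon>
    proof -
      define \<alpha> :: "real^'p" where
        "\<alpha> = (\<chi> i. if d $ i = 0 then (1 - \<epsilon>) * sgn ((D *v h) $ i) else sgn (d $ i))"
      have "S \<alpha>"
        using that by (auto simp: S_def \<alpha>_def abs_mult abs_sgn_eq)
      moreover have "P (\<epsilon> *\<^sub>R one)"
        using that by (simp add: P_def one_def)
      ultimately have "\<alpha> \<bullet> (D *v h) + \<epsilon> * (one \<bullet> (transpose \<Psi> *v h)) \<le> 0"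
        using le[of \<alpha> "\<epsilon> *\<^sub>R one" 0] by simp
      moreover have "\<alpha> \<bullet> (D *v h) =
          (\<Sum>i\<in>UNIV. abs_deriv (d $ i) ((D *v h) $ i)
             - \<epsilon> * (if d $ i = 0 then \<bar>(D *v h) $ i\<bar> else 0))"
        unfolding inner_vec_def
        by (intro sum.cong) (auto simp: \<alpha>_def abs_deriv_def algebra_simps abs_sgn)
      ultimately show ?thesis
        by (simp add: g_def M_def sum_subtractf sum_distrib_left algebra_simps)
    qed
    have "((\<lambda>\<epsilon>. \<epsilon> * M) \<longlongrightarrow> 0 * M) (at_right 0)"
      by (intro tendsto_intros)
    moreover have "\<forall>\<^sub>F \<epsilon> in at_right 0. g \<le> \<epsilon> * M"
      using eventually_at_right_real[of 0 1] by (auto elim!: eventually_mono intro: g_le)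
    ultimately have "g \<le> 0 * M"
      by (rule tendsto_lowerbound) simp
    moreover have "0 < g"
      unfolding g_def using \<open>a \<noteq> 0\<close> Ah \<Psi>h by (intro pos) (auto simp: h_def)
    ultimately show False by simp
  qed
  then obtain \<alpha> \<mu> y where *: "S \<alpha>" "P \<mu>"
    and zero: "transpose D *v \<alpha> + \<Psi> *v \<mu> + transpose A *v y = 0"
    by blast
  have "transpose D *v \<alpha> + \<Psi> *v \<mu> = transpose A *v (- y)"
    using zero by (simp only: linear_neg[OF matrix_vector_mul_linear] eq_neg_iff_add_eq_0)
  then have "transpose D *v \<alpha> + \<Psi> *v \<mu> \<in> matrix_range (transpose A)"
    by (auto simp: matrix_range_def)
  with * show thesis
    by (intro that[of \<alpha> \<mu>]) (auto simp: S_def P_def split: if_splits)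
qed

text \<open>On the subspace below, \<open>D h\<close> vanishes wherever \<open>d\<close> does, so the absolute values drop out of
  the derivative; being linear there, it cannot be positive at both \<open>h\<close> and \<open>-h\<close>.\<close>

lemma pos_imp_nullspace_trivial:
  fixes A :: "real^'n^'m" and D :: "real^'n^'p" and \<Psi> :: "real^'n^'q"
  assumes pos: "\<And>h. h \<noteq> 0 \<Longrightarrow> A *v h = 0 \<Longrightarrow> (\<And>i. (\<Psi> *v h) $ i \<le> 0) \<Longrightarrow>
    0 < (\<Sum>i\<in>UNIV. abs_deriv (d $ i) ((D *v h) $ i))"
  shows "nullspace A \<inter> nullspace_rows D {i. d $ i = 0} \<inter> nullspace \<Psi> = {0}"
proof -
  have "h = 0" if "h \<in> nullspace A \<inter> nullspace_rows D {i. d $ i = 0} \<inter> nullspace \<Psi>" for h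
  proof (rule ccontr)
    assume "h \<noteq> 0"
    have neg: "M *v (- h) = - (M *v h)" for M :: "real^'n^'k"
      by (rule linear_neg[OF matrix_vector_mul_linear])
    have h: "A *v h = 0" "\<Psi> *v h = 0" "\<And>i. d $ i = 0 \<Longrightarrow> (D *v h) $ i = 0"
      using that by (auto simp: nullspace_def nullspace_rows_def)
    have "0 < (\<Sum>i\<in>UNIV. abs_deriv (d $ i) ((D *v h) $ i))"
      using \<open>h \<noteq> 0\<close> h by (intro pos) auto
    moreover have "0 < (\<Sum>i\<in>UNIV. abs_deriv (d $ i) ((D *v (- h)) $ i))"
      using \<open>h \<noteq> 0\<close> h by (intro pos) (auto simp: neg)
    moreover have "(\<Sum>i\<in>UNIV. abs_deriv (d $ i) ((D *v (- h)) $ i)) =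
        - (\<Sum>i\<in>UNIV. abs_deriv (d $ i) ((D *v h) $ i))"
      unfolding sum_negf[symmetric] using h(3)
      by (intro sum.cong) (auto simp: neg abs_deriv_def)
    ultimately show False by simp
  qed
  then show ?thesis
    by (auto simp: nullspace_def nullspace_rows_def)
qed

section \<open>The characterization of uniqueness\<close>

theorem theorem2p2:
  fixes A :: "real^'n^'m" and D :: "real^'n^'p"
    and l u :: "ereal^'n" and xbar :: "real^'n" and b :: "real^'m"
    and \<Lambda> :: "'p set" and \<Psi> :: "real^'n^'n"
  assumes "\<And>i. l $ i \<noteq> \<infinity>" and "\<And>i. u $ i \<noteq> -\<infinity>" and "\<And>i. l $ i < u $ i"
    and "b = A *v xbar"
    and "xbar \<in> solutions (objective A D b l u)"
    and "\<Lambda> = {i. (D *v xbar) $ i = 0}"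
    and "\<Psi> = active_bounds_matrix l u xbar"
  shows "solutions (objective A D b l u) = {xbar} \<longleftrightarrow>
    nullspace A \<inter> nullspace_rows D \<Lambda> \<inter> nullspace \<Psi> = {0} \<and>
    (\<exists>\<alpha> :: real^'p. \<exists>\<mu> :: real^'n.
       transpose D *v \<alpha> + \<Psi> *v \<mu> \<in> matrix_range (transpose A) \<and>
       (\<forall>i \<in> - \<Lambda>. \<alpha> $ i = sgn ((D *v xbar) $ i)) \<and>
       max_norm_on \<Lambda> \<alpha> < 1 \<and>
       (\<forall>i. \<mu> $ i > 0))"
    (is "?unique \<longleftrightarrow> ?null \<and> ?cert")
proof -
  let ?pos = "\<forall>h. h \<noteq> 0 \<and> A *v h = 0 \<and> (\<forall>i. (\<Psi> *v h) $ i \<le> 0) \<longrightarrow>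
    0 < (\<Sum>i\<in>UNIV. abs_deriv ((D *v xbar) $ i) ((D *v h) $ i))"
  have sym: "transpose \<Psi> = \<Psi>"
    by (simp add: assms(7) transpose_active_bounds_matrix)
  have "?unique \<longleftrightarrow> ?pos"
    unfolding assms(7) using assms(3,5) by (rule unique_solution_iff)
  also have "?pos \<longleftrightarrow> ?null \<and> ?cert"
  proof (intro iffI conjI)
    assume pos: ?pos
    show ?null
      unfolding assms(6) using pos by (intro pos_imp_nullspace_trivial) blast
    show ?cert
    proof (rule pos_imp_certificate[of A \<Psi> "D *v xbar" D])
      fix h
      assume "h \<noteq> 0" "A *v h = 0" "\<And>i. (transpose \<Psi> *v h) $ i \<le> 0"
      with pos show "0 < (\<Sum>i\<in>UNIV. abs_deriv ((D *v xbar) $ i) ((D *v h) $ i))"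
        by (simp add: sym)
    next
      fix \<alpha> \<mu>
      assume "transpose D *v \<alpha> + \<Psi> *v \<mu> \<in> matrix_range (transpose A)"
        and "\<And>i. (D *v xbar) $ i \<noteq> 0 \<Longrightarrow> \<alpha> $ i = sgn ((D *v xbar) $ i)"
        and "\<And>i. (D *v xbar) $ i = 0 \<Longrightarrow> \<bar>\<alpha> $ i\<bar> < 1" and "\<And>i. \<mu> $ i > 0"
      then show ?cert
        unfolding max_norm_on_less_one_iff assms(6)
        by (intro exI[of _ \<alpha>] exI[of _ \<mu>]) auto
    qed
  next
    assume nc: "?null \<and> ?cert"
    then obtain \<alpha> \<mu> where cert: "transpose D *v \<alpha> + \<Psi> *v \<mu> \<in> matrix_range (transpose A)"
      and \<alpha>: "\<forall>i \<in> - \<Lambda>. \<alpha> $ i = sgn ((D *v xbar) $ i)" "max_norm_on \<Lambda> \<alpha> < 1"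
      and \<mu>: "\<forall>i. \<mu> $ i > 0"
      by blast
    show ?pos
    proof (intro allI impI, elim conjE)
      fix h
      assume h: "h \<noteq> 0" "A *v h = 0" "\<forall>i. (\<Psi> *v h) $ i \<le> 0"
      then have "h \<notin> nullspace_rows D \<Lambda> \<inter> nullspace \<Psi>"
        using nc by (auto simp: nullspace_def)
      then show "0 < (\<Sum>i\<in>UNIV. abs_deriv ((D *v xbar) $ i) ((D *v h) $ i))"
        using \<alpha> \<mu> h unfolding max_norm_on_less_one_iff assms(6)
        by (intro certificate_imp_pos[OF cert]) (auto simp: sym)
    qed
  qed
  finally show ?thesis .
qed

end
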